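(* Let $p$ be a prime, let $A\in M_2(\mathbb{F}_p)$, and let $R=\{B\in M_2(\mathbb{F}_p) : B^3=A\}$ be the set of cube roots of $A$. (1) If $A=0$, then $R=\{B\in M_2(\mathbb{F}_p) : \det B=0,\ \operatorname{tr}B=0\}$. (2) If $A=c^3E$ for some $c\in\mathbb{F}_p\setminus\{0\}$, then $R=\{cB : B\in M_2(\mathbb{F}_p),\ B^3=E\}$. (3) In all other cases, for every $B\in R$ there are $a,b\in\mathbb{F}_p$ with $a=\operatorname{tr}B$, $b^3=\det A$, $a^3-3ab=\operatorname{tr}A$, $a^2-b\neq 0$ and $$B=\frac{A+ab\,E}{a^2-b}.$$
   Context: $M_2(\mathbb{F}_p)$ is the ring of $2\times2$ matrices over $\mathbb{F}_p$, and $E$ is the identity matrix. *)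

theory Defs
  imports "Jordan_Normal_Form.Determinant" "Berlekamp_Zassenhaus.Finite_Field"
begin

text \<open>The field \<open>\<bbbF>\<^sub>p\<close> is \<^typ>\<open>'p::prime_card mod_ring\<close> with \<open>p = CARD('p)\<close>.\<close>

definition mat_trace :: "'a::comm_monoid_add mat \<Rightarrow> 'a" where
  "mat_trace B = (\<Sum>i<dim_row B. B $$ (i, i))"

definition cube_roots :: "'a::semiring_1 mat \<Rightarrow> 'a mat set" where
  "cube_roots A = {B \<in> carrier_mat 2 2. B ^\<^sub>m 3 = A}"

end

theory Submission
  imports Defs
begin

text \<open>By Cayley--Hamilton, a \<open>2 \<times> 2\<close> matrix \<open>B\<close> with trace \<open>a\<close> and determinant \<open>b\<close> satisfies
  \<open>B\<^sup>3 = (a\<^sup>2 - b) B - a b E\<close>. If \<open>B\<^sup>3 = A\<close> and \<open>a\<^sup>2 \<noteq> b\<close>, this can be solved for \<open>B\<close>, and taking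
  traces and determinants gives the conditions on \<open>a\<close> and \<open>b\<close>. If \<open>a\<^sup>2 = b\<close>, then
  \<open>A = (-a)\<^sup>3 E\<close>, so \<open>A\<close> falls under one of the first two cases.\<close>

lemma mat_trace_2x2:
  "B \<in> carrier_mat 2 2 \<Longrightarrow> mat_trace B = B $$ (0, 0) + B $$ (1, 1)"
  by (simp add: mat_trace_def numeral_2_eq_2)

lemma det_2x2:
  fixes B :: "'a::comm_ring_1 mat"
  assumes B: "B \<in> carrier_mat 2 2"
  shows "det B = B $$ (0, 0) * B $$ (1, 1) - B $$ (0, 1) * B $$ (1, 0)"
  using B by (subst laplace_expansion_row[OF B, of 0])
    (auto simp: numeral_2_eq_2 cofactor_def det_single mat_delete_def)

lemma pow_mat_3:
  assumes "B \<in> carrier_mat n n"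
  shows "B ^\<^sub>m 3 = B * B * B"
  using assms by (simp add: numeral_3_eq_3)

text \<open>Multiplying Cayley-Hamilton, B^2 = a B - b E, by B and reducing B^2 once more gives the
  formula. The proof bypasses the characteristic polynomial: each of the four entries is a
  polynomial identity, so any commutative ring will do.\<close>

lemma mat_cube_2x2:
  fixes B :: "'a::comm_ring_1 mat"
  assumes B: "B \<in> carrier_mat 2 2"
  shows "B ^\<^sub>m 3 = (mat_trace B ^ 2 - det B) \<cdot>\<^sub>m B - (mat_trace B * det B) \<cdot>\<^sub>m 1\<^sub>m 2"
  unfolding pow_mat_3[OF B] mat_trace_2x2[OF B] det_2x2[OF B]
proof (rule eq_matI, goal_cases)
  case (1 i j)
  then have "i = 0 \<or> i = 1" "j = 0 \<or> j = 1" by auto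
  then show ?case
    using B by (auto simp: scalar_prod_def numeral_2_eq_2 power2_eq_square algebra_simps)
qed (use B in auto)

lemma smult_smult_mat:
  fixes B :: "'a::semigroup_mult mat"
  shows "a \<cdot>\<^sub>m (b \<cdot>\<^sub>m B) = (a * b) \<cdot>\<^sub>m B"
  by (rule eq_matI) (auto simp: mult.assoc)

lemma smult_mat_cube:
  fixes B :: "'a::comm_ring_1 mat"
  assumes "B \<in> carrier_mat n n"
  shows "(c \<cdot>\<^sub>m B) ^\<^sub>m 3 = c ^ 3 \<cdot>\<^sub>m (B ^\<^sub>m 3)"
proof -
  have cB: "c \<cdot>\<^sub>m B \<in> carrier_mat n n" using assms by simp
  then show ?thesis
    unfolding pow_mat_3[OF assms] pow_mat_3[OF cB]
    using assms
    by (simp add: mult_smult_distrib[of _ n n _ n] mult_smult_assoc_mat[of _ n n _ n]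
        smult_smult_mat power3_eq_cube mult.assoc)
qed

lemma det_mat_cube:
  fixes B :: "'a::comm_ring_1 mat"
  assumes "B \<in> carrier_mat n n"
  shows "det (B ^\<^sub>m 3) = det B ^ 3"
  using assms by (simp add: pow_mat_3 det_mult[of _ n] power3_eq_cube)

text \<open>Taking traces in the cube formula, with trace 2 for the identity matrix, gives (a^2 - b)
  a - 2 a b.\<close>

lemma mat_trace_cube_2x2:
  fixes B :: "'a::comm_ring_1 mat"
  assumes B: "B \<in> carrier_mat 2 2"
  shows "mat_trace (B ^\<^sub>m 3) = mat_trace B ^ 3 - 3 * mat_trace B * det B"
proof -
  have "B ^\<^sub>m 3 \<in> carrier_mat 2 2" using B by simp
  from mat_trace_2x2[OF this] show ?thesis
    unfolding mat_cube_2x2[OF B] using B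
    by (simp add: mat_trace_2x2[OF B] algebra_simps power2_eq_square power3_eq_cube)
qed

text \<open>A field has no nilpotents: the determinant of the cube forces \<open>det B = 0\<close>,
  and then the trace of the cube is just the cube of the trace. Conversely, both coefficients in the
  cube formula vanish.\<close>

lemma cube_roots_zero:
  "cube_roots (0\<^sub>m 2 2 :: 'a::field mat) = {B \<in> carrier_mat 2 2. det B = 0 \<and> mat_trace B = 0}"
proof -
  have "B ^\<^sub>m 3 = 0\<^sub>m 2 2 \<longleftrightarrow> det B = 0 \<and> mat_trace B = 0"
    if B: "B \<in> carrier_mat 2 2" for B :: "'a mat"
  proof
    assume cube: "B ^\<^sub>m 3 = 0\<^sub>m 2 2"
    have "det B ^ 3 = 0"
      using det_mat_cube[OF B] cube by (simp add: det_zero)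
    then have det: "det B = 0" by simp
    have "mat_trace B ^ 3 = 0"
      using mat_trace_cube_2x2[OF B] cube det by (simp add: mat_trace_def)
    with det show "det B = 0 \<and> mat_trace B = 0" by simp
  next
    assume "det B = 0 \<and> mat_trace B = 0"
    then show "B ^\<^sub>m 3 = 0\<^sub>m 2 2"
      using B by (auto simp: mat_cube_2x2[OF B] intro!: eq_matI)
  qed
  then show ?thesis by (auto simp: cube_roots_def)
qed

text \<open>Scaling by the invertible \<open>c\<close> multiplies cubes by \<open>c ^ 3\<close>, so
  it carries the cube roots of the identity onto those of the scalar matrix; scaling by
  \<open>inverse c\<close> undoes it.\<close>

lemma cube_roots_scalar:
  fixes c :: "'a::field"
  assumes "c \<noteq> 0"
  shows "cube_roots (c ^ 3 \<cdot>\<^sub>m 1\<^sub>m 2) = {c \<cdot>\<^sub>m B |B. B \<in> carrier_mat 2 2 \<and> B ^\<^sub>m 3 = 1\<^sub>m 2}"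
proof (intro equalityI subsetI)
  fix B assume "B \<in> cube_roots (c ^ 3 \<cdot>\<^sub>m 1\<^sub>m 2)"
  then have B: "B \<in> carrier_mat 2 2" and cube: "B ^\<^sub>m 3 = c ^ 3 \<cdot>\<^sub>m 1\<^sub>m 2"
    by (auto simp: cube_roots_def)
  have "(inverse c \<cdot>\<^sub>m B) ^\<^sub>m 3 = 1\<^sub>m 2"
    unfolding smult_mat_cube[OF B] cube using assms
    by (auto intro!: eq_matI simp: power_inverse)
  moreover have "B = c \<cdot>\<^sub>m (inverse c \<cdot>\<^sub>m B)"
    using assms by (auto intro!: eq_matI)
  ultimately show "B \<in> {c \<cdot>\<^sub>m B |B. B \<in> carrier_mat 2 2 \<and> B ^\<^sub>m 3 = 1\<^sub>m 2}"
    using B by (auto intro!: exI[of _ "inverse c \<cdot>\<^sub>m B"])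
qed (auto simp: cube_roots_def smult_mat_cube)

lemma cube_root_formula:
  fixes A :: "'a::field mat"
  assumes nonzero: "A \<noteq> 0\<^sub>m 2 2"
    and nonscalar: "\<nexists>c. c \<noteq> 0 \<and> A = c ^ 3 \<cdot>\<^sub>m 1\<^sub>m 2"
    and B: "B \<in> carrier_mat 2 2" and cube: "B ^\<^sub>m 3 = A"
  defines "a \<equiv> mat_trace B" and "b \<equiv> det B"
  shows "a ^ 2 - b \<noteq> 0" and "B = (1 / (a ^ 2 - b)) \<cdot>\<^sub>m (A + (a * b) \<cdot>\<^sub>m 1\<^sub>m 2)"
proof -
  have A: "A = (a ^ 2 - b) \<cdot>\<^sub>m B - (a * b) \<cdot>\<^sub>m 1\<^sub>m 2"
    using mat_cube_2x2[OF B] cube by (simp add: a_def b_def)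
  show ne: "a ^ 2 - b \<noteq> 0"
  proof
    assume "a ^ 2 - b = 0"
    then have "b = a ^ 2" by simp
    \<comment> \<open>The coefficient of \<open>B\<close> vanishes, and what remains is -a b = -a^3
      = (-a)^3 times the identity.\<close>
    with A B have scalar: "A = (- a) ^ 3 \<cdot>\<^sub>m 1\<^sub>m 2"
      by (auto intro!: eq_matI simp: power2_eq_square power3_eq_cube)
    show False
    proof (cases "a = 0")
      case True
      with scalar have "A = 0\<^sub>m 2 2" by (auto intro!: eq_matI)
      with nonzero show False ..
    next
      case False
      \<comment> \<open>The forbidden scalar is \<open>c = - a\<close>, nonzero together with
        \<open>a\<close>.\<close>
      with scalar nonscalar show False by (metis neg_equal_0_iff_equal)
    qed
  qed
  show "B = (1 / (a ^ 2 - b)) \<cdot>\<^sub>m (A + (a * b) \<cdot>\<^sub>m 1\<^sub>m 2)"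
    unfolding A using ne B by (auto intro!: eq_matI)
qed

theorem proposition3:
  fixes A :: "'p::prime_card mod_ring mat"
  assumes "A \<in> carrier_mat 2 2"
  shows "(A = 0\<^sub>m 2 2 \<longrightarrow>
            cube_roots A = {B \<in> carrier_mat 2 2. det B = 0 \<and> mat_trace B = 0}) \<and>
         (\<forall>c. c \<noteq> 0 \<and> A = c ^ 3 \<cdot>\<^sub>m 1\<^sub>m 2 \<longrightarrow>
            cube_roots A = {c \<cdot>\<^sub>m B |B. B \<in> carrier_mat 2 2 \<and> B ^\<^sub>m 3 = 1\<^sub>m 2}) \<and>
         (A \<noteq> 0\<^sub>m 2 2 \<and> \<not> (\<exists>c. c \<noteq> 0 \<and> A = c ^ 3 \<cdot>\<^sub>m 1\<^sub>m 2) \<longrightarrow>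
            (\<forall>B \<in> cube_roots A. \<exists>a b.
               a = mat_trace B \<and> b ^ 3 = det A \<and> a ^ 3 - 3 * a * b = mat_trace A \<and>
               a ^ 2 - b \<noteq> 0 \<and>
               B = (1 / (a ^ 2 - b)) \<cdot>\<^sub>m (A + (a * b) \<cdot>\<^sub>m 1\<^sub>m 2)))"
proof (intro conjI impI allI ballI)
  fix B
  assume A: "A \<noteq> 0\<^sub>m 2 2 \<and> \<not> (\<exists>c. c \<noteq> 0 \<and> A = c ^ 3 \<cdot>\<^sub>m 1\<^sub>m 2)" and "B \<in> cube_roots A"
  then have B: "B \<in> carrier_mat 2 2" and cube: "B ^\<^sub>m 3 = A"
    by (auto simp: cube_roots_def)
  show "\<exists>a b. a = mat_trace B \<and> b ^ 3 = det A \<and> a ^ 3 - 3 * a * b = mat_trace A \<and>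
               a ^ 2 - b \<noteq> 0 \<and>
               B = (1 / (a ^ 2 - b)) \<cdot>\<^sub>m (A + (a * b) \<cdot>\<^sub>m 1\<^sub>m 2)"
    \<comment> \<open>The witness for \<open>b\<close> is \<open>det B\<close>, a cube root of
      \<open>det A\<close> because determinants are multiplicative.\<close>
    using cube_root_formula[OF conjunct1[OF A] conjunct2[OF A] B cube]
      det_mat_cube[OF B] mat_trace_cube_2x2[OF B] cube
    by (intro exI[of _ "mat_trace B"] exI[of _ "det B"] conjI) simp_all
qed (auto simp: cube_roots_zero cube_roots_scalar)

end
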